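(* Let $(\mathbb{Z},b,\mathcal{D})$ be a pre-number system with $0\in\mathcal{D}$. Then for each integer $\ell\ge 1$, there are only finitely many $d\in b\mathbb{Z}$ such that the pre-number system $(\mathbb{Z},b,(\mathcal{D}\setminus\{0\})\cup\{d\})$ has a zero expansion of length $\ell$.
   Context: A pre-number system $(\mathbb{Z},b,\mathcal{D})$ consists of an integer $b$ with $|b|\ge 2$ and a finite set $\mathcal{D}\subset\mathbb{Z}$ covering all residue classes modulo $b$; $\mathcal{D}$ is assumed irredundant, i.e. $|\mathcal{D}|=|b|$, so it has exactly one element in each residue class. A zero expansion of $(\mathbb{Z},b,\mathcal{D})$ of length $\ell\ge 1$ is a sequence $(d_0,\ldots,d_{\ell-1})$ of digits in $\mathcal{D}$ such that $\sum_{i=0}^{\ell-1}d_ib^i=0$. *)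

theory Defs
  imports "HOL-Number_Theory.Cong"
begin

text \<open>Digit sets are irredundant: the condition on the cardinality makes \<open>D\<close> a complete
  residue system modulo \<open>b\<close> with exactly one digit in each class.\<close>

definition pre_number_system :: "int \<Rightarrow> int set \<Rightarrow> bool" where
  "pre_number_system b D \<longleftrightarrow>
     \<bar>b\<bar> \<ge> 2 \<and> finite D \<and> (\<forall>x. \<exists>d\<in>D. [x = d] (mod b)) \<and> int (card D) = \<bar>b\<bar>"

definition zero_expansion :: "int \<Rightarrow> int set \<Rightarrow> int list \<Rightarrow> bool" where
  "zero_expansion b D ds \<longleftrightarrow>
     length ds \<ge> 1 \<and> set ds \<subseteq> D \<and> (\<Sum>i<length ds. ds ! i * b ^ i) = 0"

lemma pre_number_system_replace_zero:
  assumes "pre_number_system b D" and "0 \<in> D" and "b dvd d"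
  shows "pre_number_system b ((D - {0}) \<union> {d})"
proof -
  have b: "\<bar>b\<bar> \<ge> 2" and fin: "finite D" and cov: "\<And>x. \<exists>e\<in>D. [x = e] (mod b)"
    and card: "int (card D) = \<bar>b\<bar>"
    using assms(1) by (auto simp: pre_number_system_def)
  have cov': "\<exists>e\<in>(D - {0}) \<union> {d}. [x = e] (mod b)" for x
  proof -
    obtain e where e: "e \<in> D" "[x = e] (mod b)" using cov by blast
    show ?thesis
    proof (cases "e = 0")
      case True
      then have "[x = d] (mod b)" using e(2) \<open>b dvd d\<close> by (simp add: cong_def)
      then show ?thesis by blast
    qed (use e in blast)
  qed
  let ?R = "(\<lambda>x. x mod b) ` D"
  have sub: "(\<lambda>x. x mod b) ` {0..<\<bar>b\<bar>} \<subseteq> ?R"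
    using cov by (fastforce simp: cong_def)
  have inj0: "inj_on (\<lambda>x. x mod b) {0..<\<bar>b\<bar>}"
  proof (rule inj_onI)
    fix x y assume xy: "x \<in> {0..<\<bar>b\<bar>}" "y \<in> {0..<\<bar>b\<bar>}" "x mod b = y mod b"
    then have "\<bar>b\<bar> dvd x - y" by (simp add: mod_eq_dvd_iff)
    then have "x mod \<bar>b\<bar> = y mod \<bar>b\<bar>" by (simp only: mod_eq_dvd_iff)
    then show "x = y" using xy by simp
  qed
  have "card ?R \<ge> card D"
    using card_mono[OF finite_imageI[OF fin] sub] card by (simp add: card_image[OF inj0])
  then have inj: "inj_on (\<lambda>x. x mod b) D"
    using fin by (meson card_image_le eq_card_imp_inj_on le_antisym)
  have "d \<notin> D - {0}"
  proof
    assume "d \<in> D - {0}"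
    then show False
      using inj_onD[OF inj, of d 0] \<open>b dvd d\<close> \<open>0 \<in> D\<close> by simp
  qed
  moreover have "card D > 0" using card b by linarith
  ultimately have "card ((D - {0}) \<union> {d}) = card D"
    using fin \<open>0 \<in> D\<close> by (simp add: card_Diff_singleton)
  then show ?thesis
    using b fin cov' card by (simp add: pre_number_system_def del: Un_insert_right)
qed

end

theory Submission
  imports Defs
begin

text \<open>Modulo \<open>b\<close>, a zero expansion over \<open>(D - {0}) \<union> {d}\<close> shows that its units digit is
  divisible by \<open>b\<close>, hence equals \<open>d\<close>. Splitting off all occurrences of \<open>d\<close> therefore gives
  \<open>d * P + Q = 0\<close>, where \<open>P\<close> is a sum of distinct powers of \<open>b\<close> including \<open>b ^ 0\<close>, so that
  \<open>P\<close> is congruent to 1 modulo \<open>b\<close> and does not vanish, and \<open>Q\<close> only involves digits in \<open>D\<close>.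
  For a fixed length there are finitely many choices of \<open>P\<close> and \<open>Q\<close>, and they determine \<open>d\<close>.\<close>

definition digit_value :: "int \<Rightarrow> int list \<Rightarrow> int" where
  "digit_value b ds = (\<Sum>i<length ds. ds ! i * b ^ i)"

lemma digit_value_Cons: "digit_value b (x # ds) = x + b * digit_value b ds"
  unfolding digit_value_def
  by (simp del: sum.lessThan_Suc add: sum.lessThan_Suc_shift sum_distrib_left algebra_simps)

lemma digit_value_split:
  "digit_value b ds =
     d * digit_value b (map (\<lambda>x. of_bool (x = d)) ds) +
     digit_value b (map (\<lambda>x. if x = d then 0 else x) ds)"
  unfolding digit_value_def sum_distrib_left sum.distrib[symmetric] length_map
  by (rule sum.cong) (auto simp: algebra_simps)

text \<open>If \<open>x\<close> were nonzero, trading 0 for \<open>x\<close> would merely delete 0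
  from \<open>D\<close>, yet by \<open>pre_number_system_replace_zero\<close> the resulting set
  still has |b| elements.\<close>

lemma pre_number_system_dvd_digit_eq_0:
  assumes "pre_number_system b D" and "0 \<in> D" and "x \<in> D" and "b dvd x"
  shows "x = 0"
proof (rule ccontr)
  assume "x \<noteq> 0"
  then have "(D - {0}) \<union> {x} = D - {0}"
    using assms(3) by blast
  then have "card (D - {0}) = card D"
    using assms(1) pre_number_system_replace_zero[OF assms(1,2,4)]
    by (simp add: pre_number_system_def)
  moreover have "card (D - {0}) < card D"
    using assms(1,2) by (intro card_Diff1_less) (auto simp: pre_number_system_def)
  ultimately show False
    by simp
qed

theorem theorem2p12:
  fixes b :: int and D :: "int set" and l :: nat
  assumes "pre_number_system b D" and "0 \<in> D" and "l \<ge> 1"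
  shows "finite {d. b dvd d \<and> (\<exists>ds. length ds = l \<and> zero_expansion b ((D - {0}) \<union> {d}) ds)}"
proof (rule finite_subset)
  let ?M = "{ms. set ms \<subseteq> {0, 1 :: int} \<and> length ms = l}"
  let ?Q = "{xs. set xs \<subseteq> D \<and> length xs = l}"
  have b: "\<bar>b\<bar> \<ge> 2" and "finite D"
    using assms(1) by (auto simp: pre_number_system_def)
  \<comment> \<open>The quotient solves \<open>d * P + Q = 0\<close> for \<open>d\<close>, with
    \<open>ms\<close> giving P and \<open>xs\<close> giving Q; pairs with P = 0 only add the default
    value 0.\<close>
  then show "finite ((\<lambda>(ms, xs). - digit_value b xs div digit_value b ms) ` (?M \<times> ?Q))"
    by (intro finite_imageI finite_cartesian_product finite_lists_length_eq) auto
  show "{d. b dvd d \<and> (\<exists>ds. length ds = l \<and> zero_expansion b ((D - {0}) \<union> {d}) ds)}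
      \<subseteq> (\<lambda>(ms, xs). - digit_value b xs div digit_value b ms) ` (?M \<times> ?Q)"
  proof clarify
    fix d ds
    assume "b dvd d" and len: "l = length ds" and zero: "zero_expansion b ((D - {0}) \<union> {d}) ds"
    define ms where "ms = map (\<lambda>x. of_bool (x = d) :: int) ds"
    define xs where "xs = map (\<lambda>x. if x = d then 0 else x) ds"
    have digits: "set ds \<subseteq> (D - {0}) \<union> {d}" and val: "digit_value b ds = 0"
      using zero by (auto simp: zero_expansion_def digit_value_def)
    obtain x es where ds: "ds = x # es"
      using assms(3) len by (cases ds) auto
    have "x = - (b * digit_value b es)"
      using val by (simp add: ds digit_value_Cons)
    then have "b dvd x"
      by simp
    \<comment> \<open>Otherwise \<open>x\<close> lies in \<open>D - {0}\<close>, where no digit is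
      divisible by \<open>b\<close>.\<close>
    then have "x = d"
      using digits pre_number_system_dvd_digit_eq_0[OF assms(1,2)] by (auto simp: ds)
    then have P: "digit_value b ms = 1 + b * digit_value b (tl ms)"
      by (simp add: ms_def ds digit_value_Cons)
    have "digit_value b ms \<noteq> 0"
    proof
      assume "digit_value b ms = 0"
      then have "1 = b * (- digit_value b (tl ms))"
        using P by simp
      then have "b dvd 1" ..
      then show False
        using b by simp
    qed
    moreover have "- digit_value b xs = d * digit_value b ms"
      using digit_value_split[of b ds d] val by (simp add: ms_def xs_def)
    ultimately have "d = - digit_value b xs div digit_value b ms"
      by simp
    moreover have "ms \<in> {ms. set ms \<subseteq> {0, 1} \<and> length ms = length ds}"
      by (auto simp: ms_def)
    \<comment> \<open>The zeros written over \<open>d\<close> are themselves digits, as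
      \<open>0 \<in> D\<close>.\<close>
    moreover have "xs \<in> {xs. set xs \<subseteq> D \<and> length xs = length ds}"
      using digits assms(2) by (auto simp: xs_def)
    ultimately show "d \<in> (\<lambda>(ms, xs). - digit_value b xs div digit_value b ms) `
        ({ms. set ms \<subseteq> {0, 1} \<and> length ms = length ds} \<times>
         {xs. set xs \<subseteq> D \<and> length xs = length ds})"
      by (intro image_eqI[of _ _ "(ms, xs)"]) simp_all
  qed
qed

end
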